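(* Let $G_1$ be an $r_1$-regular graph on $n_1$ vertices and $m_1$ edges, and $G_2$ an arbitrary graph on $n_2$ vertices. Then, as an identity of rational functions in $x$, $$\phi(A(G_1 \odot G_2); x) = x^{m_1 - n_1} \cdot (\phi(A(G_2); x))^{n_1} \cdot \prod_{i=1}^{n_1} \left(x^2 - \Gamma_{A(G_2)}(x)\,x - r_1 - \lambda_i(G_1) \right).$$
   Context: All graphs are finite, simple and undirected. For a graph $G$, $A(G)$ is its adjacency matrix and $\phi(M;x)=\det(xI-M)$ denotes the characteristic polynomial of a square matrix $M$. The adjacency eigenvalues of a graph $G$ on $n$ vertices are $\lambda_1(G)\ge\lambda_2(G)\ge\dots\ge\lambda_n(G)$. For an $n\times n$ matrix $M$, the $M$-coronal is the rational function $\Gamma_M(x)=\mathbf{1}_n^T(xI_n-M)^{-1}\mathbf{1}_n$, where $\mathbf{1}_n$ is the all-ones column vector of length $n$. The subdivision graph $\mathcal{S}(G)$ is obtained from $G$ by inserting a new vertex into every edge of $G$. The subdivision-vertex corona $G_1\odot G_2$ of two vertex-disjoint graphs is the graph obtained from $\mathcal{S}(G_1)$ and $|V(G_1)|$ copies of $G_2$, all vertex-disjoint, by joining the $i$th vertex of $V(G_1)$ to every vertex in the $i$th copy of $G_2$. *)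

theory Defs
  imports
    "HOL-Computational_Algebra.Computational_Algebra"
    "Jordan_Normal_Form.Char_Poly"
    "Jordan_Normal_Form.Gauss_Jordan_Elimination"
    "Graph_Theory.Graph_Theory"
begin

text \<open>
  A finite simple undirected graph is a \<^const>\<open>pair_graph\<close>: the arc relation is finite, symmetric
  and loop-free, so an undirected edge is a pair of opposite arcs.
\<close>

definition uedges :: "'a pair_pre_digraph \<Rightarrow> 'a set set" where
  "uedges G = (\<lambda>(u, v). {u, v}) ` parcs G"

definition regular_graph :: "nat \<Rightarrow> 'a pair_pre_digraph \<Rightarrow> bool" where
  "regular_graph r G \<longleftrightarrow> (\<forall>v \<in> pverts G. out_degree (with_proj G) v = r)"

definition vertex_enumeration :: "'a pair_pre_digraph \<Rightarrow> 'a list \<Rightarrow> bool" where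
  "vertex_enumeration G vs \<longleftrightarrow> distinct vs \<and> set vs = pverts G"

definition adjacency_matrix :: "'a pair_pre_digraph \<Rightarrow> 'a list \<Rightarrow> real mat" where
  "adjacency_matrix G vs =
     mat (length vs) (length vs) (\<lambda>(i, j). if (vs ! i, vs ! j) \<in> parcs G then 1 else 0)"

text \<open>
  The eigenvalues of a real matrix with only real eigenvalues, in non-increasing order and repeated
  according to algebraic multiplicity, starting from index 1.
\<close>

definition nth_eigenvalue :: "real mat \<Rightarrow> nat \<Rightarrow> real" where
  "nth_eigenvalue M i = rev (sorted_list_of_multiset (proots (char_poly M))) ! (i - 1)"

text \<open>Rational functions are elements of the fraction field of the polynomial ring.\<close>

type_synonym ratfun = "real poly fract"

definition ratfun_X :: ratfun where
  "ratfun_X = to_fract [:0, 1:]"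

definition ratfun_const :: "real \<Rightarrow> ratfun" where
  "ratfun_const c = to_fract [:c:]"

text \<open>The matrix $xI - M$ is invertible over the rational functions, its determinant being monic.\<close>

definition coronal :: "real mat \<Rightarrow> ratfun" where
  "coronal M =
     (let n = dim_row M; one = vec n (\<lambda>_. 1)
      in one \<bullet> (the (mat_inverse (ratfun_X \<cdot>\<^sub>m 1\<^sub>m n - map_mat ratfun_const M)) *\<^sub>v one))"

datatype 'a subdivision_vertex = Orig 'a | Mid "'a set"

definition subdivision_graph :: "'a pair_pre_digraph \<Rightarrow> 'a subdivision_vertex pair_pre_digraph" where
  "subdivision_graph G =
     \<lparr> pverts = Orig ` pverts G \<union> Mid ` uedges G,
       parcs = {(Orig v, Mid e) | v e. e \<in> uedges G \<and> v \<in> e}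
             \<union> {(Mid e, Orig v) | v e. e \<in> uedges G \<and> v \<in> e} \<rparr>"

text \<open>\<open>Copy v w\<close> is the vertex \<open>w\<close> in the copy of the second graph attached to \<open>v\<close>.\<close>

datatype ('a, 'b) corona_vertex = Sub "'a subdivision_vertex" | Copy 'a 'b

definition subdivision_vertex_corona ::
    "'a pair_pre_digraph \<Rightarrow> 'b pair_pre_digraph \<Rightarrow> ('a, 'b) corona_vertex pair_pre_digraph" where
  "subdivision_vertex_corona G H =
     \<lparr> pverts = Sub ` pverts (subdivision_graph G)
              \<union> {Copy v w | v w. v \<in> pverts G \<and> w \<in> pverts H},
       parcs = {(Sub s, Sub t) | s t. (s, t) \<in> parcs (subdivision_graph G)}
             \<union> {(Copy v w, Copy v w') | v w w'. v \<in> pverts G \<and> (w, w') \<in> parcs H}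
             \<union> {(Sub (Orig v), Copy v w) | v w. v \<in> pverts G \<and> w \<in> pverts H}
             \<union> {(Copy v w, Sub (Orig v)) | v w. v \<in> pverts G \<and> w \<in> pverts H} \<rparr>"

lemma finite_uedges: "pair_graph G \<Longrightarrow> finite (uedges G)"
  unfolding uedges_def by (simp add: pair_fin_digraph.pair_finite_arcs pair_graph_def pair_digraph_def)

lemma pair_graph_subdivision_graph:
  assumes "pair_graph G"
  shows "pair_graph (subdivision_graph G)"
proof -
  interpret pair_graph G by fact
  have sub: "e \<subseteq> pverts G" if "e \<in> uedges G" for e
    using that in_arcsD1 in_arcsD2 by (auto simp: uedges_def)
  have fin: "finite (pverts (subdivision_graph G))"
    using finite_uedges[OF assms] by (simp add: subdivision_graph_def pair_finite_verts)
  have wf: "parcs (subdivision_graph G) \<subseteq> pverts (subdivision_graph G) \<times> pverts (subdivision_graph G)"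
    using sub by (fastforce simp: subdivision_graph_def)
  show ?thesis
  proof unfold_locales
    show "finite (parcs (subdivision_graph G))"
      using finite_subset[OF wf] fin by simp
    show "symmetric (with_proj (subdivision_graph G))"
      by (auto simp: symmetric_def sym_def subdivision_graph_def)
  next
    fix e assume "e \<in> parcs (subdivision_graph G)"
    then show "fst e \<noteq> snd e" by (auto simp: subdivision_graph_def)
  qed (use wf fin in auto)
qed

lemma pair_graph_subdivision_vertex_corona:
  assumes "pair_graph G" and "pair_graph H"
  shows "pair_graph (subdivision_vertex_corona G H)"
proof -
  let ?S = "subdivision_graph G" and ?C = "subdivision_vertex_corona G H"
  interpret G: pair_graph G by fact
  interpret H: pair_graph H by fact
  interpret S: pair_graph ?S using pair_graph_subdivision_graph[OF assms(1)] .
  have "{Copy v w | v w. v \<in> pverts G \<and> w \<in> pverts H} = case_prod Copy ` (pverts G \<times> pverts H)"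
    by auto
  then have fin: "finite (pverts ?C)"
    using S.pair_finite_verts G.pair_finite_verts H.pair_finite_verts
    by (simp add: subdivision_vertex_corona_def)
  have orig: "Orig v \<in> pverts ?S" if "v \<in> pverts G" for v
    using that by (simp add: subdivision_graph_def)
  have wf: "parcs ?C \<subseteq> pverts ?C \<times> pverts ?C"
    using orig S.in_arcsD1 S.in_arcsD2 H.in_arcsD1 H.in_arcsD2
    by (auto simp: subdivision_vertex_corona_def)
  have symS: "sym (parcs ?S)" and symH: "sym (parcs H)"
    using S.pair_sym_arcs H.pair_sym_arcs by (simp_all add: symmetric_def)
  show ?thesis
  proof unfold_locales
    show "finite (parcs ?C)"
      using finite_subset[OF wf] fin by simp
    show "symmetric (with_proj ?C)"
      using symS symH by (auto simp: symmetric_def sym_def subdivision_vertex_corona_def)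
  next
    fix e assume "e \<in> parcs ?C"
    then show "fst e \<noteq> snd e"
      using S.pair_no_loops H.pair_no_loops by (fastforce simp: subdivision_vertex_corona_def)
  qed (use wf fin in auto)
qed

end

theory Submission
  imports Defs
begin

text \<open>
  Order the vertices of the corona as original vertices, edge midpoints, copies. Over the field of
  rational functions, \<open>x I - A(G\<^sub>1 \<odot> G\<^sub>2)\<close> has a lower right block \<open>D\<close> that is block diagonal with
  determinant \<open>x^m\<^sub>1 * \<phi>(A(G\<^sub>2); x)^n\<^sub>1\<close>. With \<open>R\<close> the incidence matrix of \<open>G\<^sub>1\<close>, the Schur
  complement of \<open>D\<close> is \<open>x I - R R\<^sup>T / x - \<Gamma> I\<close>, and regularity gives \<open>R R\<^sup>T = A(G\<^sub>1) + r\<^sub>1 I\<close>.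
  Multiplying by \<open>x\<close>, its determinant is \<open>x^(-n\<^sub>1)\<close> times the characteristic polynomial of
  \<open>A(G\<^sub>1)\<close> at \<open>x\<^sup>2 - \<Gamma> x - r\<^sub>1\<close>, which splits because \<open>A(G\<^sub>1)\<close> is real symmetric.
\<close>

section \<open>Matrices indexed by labels\<close>

text \<open>
  Indexing by labels instead of positions turns matrix products into sums over sets of vertices and
  makes reorderings of the vertices conjugations by labelled Kronecker deltas.
\<close>

definition labelled_mat :: "'a list \<Rightarrow> 'b list \<Rightarrow> ('a \<Rightarrow> 'b \<Rightarrow> 'c) \<Rightarrow> 'c mat" where
  "labelled_mat xs ys f = mat (length xs) (length ys) (\<lambda>(i, j). f (xs ! i) (ys ! j))"

lemma labelled_mat_carrier [simp]: "labelled_mat xs ys f \<in> carrier_mat (length xs) (length ys)"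
  by (simp add: labelled_mat_def)

lemma dim_labelled_mat [simp]:
  "dim_row (labelled_mat xs ys f) = length xs" "dim_col (labelled_mat xs ys f) = length ys"
  by (simp_all add: labelled_mat_def)

lemma index_labelled_mat [simp]:
  "i < length xs \<Longrightarrow> j < length ys \<Longrightarrow> labelled_mat xs ys f $$ (i, j) = f (xs ! i) (ys ! j)"
  by (simp add: labelled_mat_def)

lemma labelled_mat_cong:
  assumes "\<And>x y. x \<in> set xs \<Longrightarrow> y \<in> set ys \<Longrightarrow> f x y = g x y"
  shows "labelled_mat xs ys f = labelled_mat xs ys g"
  using assms by (intro eq_matI) auto

lemma labelled_mat_map:
  "labelled_mat (map h xs) (map k ys) f = labelled_mat xs ys (\<lambda>x y. f (h x) (k y))"
  by (intro eq_matI) auto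

lemma labelled_mat_append:
  "labelled_mat (xs @ ys) (xs' @ ys') f =
     four_block_mat (labelled_mat xs xs' f) (labelled_mat xs ys' f)
       (labelled_mat ys xs' f) (labelled_mat ys ys' f)"
  by (intro eq_matI) (auto simp: nth_append)

lemma labelled_mat_add:
  "labelled_mat xs ys f + labelled_mat xs ys g = labelled_mat xs ys (\<lambda>x y. f x y + g x y)"
  by (intro eq_matI) auto

lemma labelled_mat_smult:
  "c \<cdot>\<^sub>m labelled_mat xs ys f = labelled_mat xs ys (\<lambda>x y. c * f x y)"
  by (intro eq_matI) auto

lemma labelled_mat_zero: "labelled_mat xs ys (\<lambda>_ _. 0) = 0\<^sub>m (length xs) (length ys)"
  by (intro eq_matI) auto

lemma labelled_mat_one:
  "distinct xs \<Longrightarrow> labelled_mat xs xs (\<lambda>x y. if x = y then 1 else 0) = 1\<^sub>m (length xs)"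
  by (intro eq_matI) (auto simp: nth_eq_iff_index_eq)

lemma sum_nth_distinct:
  assumes "distinct xs"
  shows "(\<Sum>i = 0..<length xs. f (xs ! i)) = sum f (set xs)"
  using sum.reindex_bij_betw[OF bij_betw_nth[OF assms refl refl], of f]
  by (simp add: atLeast0LessThan)

lemma labelled_mat_mult:
  fixes f :: "'a \<Rightarrow> 'b \<Rightarrow> 'd :: comm_ring_1"
  assumes "distinct ys"
  shows "labelled_mat xs ys f * labelled_mat ys zs g =
    labelled_mat xs zs (\<lambda>x z. \<Sum>y\<in>set ys. f x y * g y z)"
  using sum_nth_distinct[OF assms]
  by (intro eq_matI) (auto simp: scalar_prod_def)

lemma sum_delta_mult:
  fixes g :: "'a \<Rightarrow> 'b :: semiring_1"
  assumes "finite S"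
  shows "(\<Sum>y\<in>S. (if x = y then 1 else 0) * g y) = (if x \<in> S then g x else 0)"
    and "(\<Sum>y\<in>S. g y * (if y = x then 1 else 0)) = (if x \<in> S then g x else 0)"
proof -
  have "(\<Sum>y\<in>S. (if x = y then 1 else 0) * g y) = (\<Sum>y\<in>S. if x = y then g y else 0)"
    by (intro sum.cong) auto
  then show "(\<Sum>y\<in>S. (if x = y then 1 else 0) * g y) = (if x \<in> S then g x else 0)"
    using assms by simp
  have "(\<Sum>y\<in>S. g y * (if y = x then 1 else 0)) = (\<Sum>y\<in>S. if y = x then g y else 0)"
    by (intro sum.cong) auto
  then show "(\<Sum>y\<in>S. g y * (if y = x then 1 else 0)) = (if x \<in> S then g x else 0)"
    using assms by simp
qed

section \<open>Determinants of labelled matrices\<close>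

text \<open>The delta matrices \<open>?P\<close> and \<open>?Q\<close> between the two orders are
  inverse permutation matrices, so their determinants cancel. This permits computing the
  characteristic polynomial of the corona in the order that suits the block structure.\<close>

lemma det_labelled_mat_cong_set:
  fixes f :: "'a \<Rightarrow> 'a \<Rightarrow> 'd :: comm_ring_1"
  assumes "distinct xs" "distinct ys" "set xs = set ys"
  shows "det (labelled_mat xs xs f) = det (labelled_mat ys ys f)"
proof -
  have len: "length xs = length ys"
    using assms by (metis distinct_card)
  let ?d = "\<lambda>x y :: 'a. if x = y then 1 else 0 :: 'd"
  let ?P = "labelled_mat xs ys ?d" and ?Q = "labelled_mat ys xs ?d"
  let ?n = "length ys"
  have car: "?P \<in> carrier_mat ?n ?n" "?Q \<in> carrier_mat ?n ?n"
    "labelled_mat ys ys f \<in> carrier_mat ?n ?n" "?P * labelled_mat ys ys f \<in> carrier_mat ?n ?n"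
    by (intro carrier_matI; simp add: len)+
  have "?P * ?Q = labelled_mat xs xs ?d"
    unfolding labelled_mat_mult[OF assms(2)]
    by (intro labelled_mat_cong) (simp add: assms sum_delta_mult)
  then have "?P * ?Q = 1\<^sub>m ?n"
    by (simp add: labelled_mat_one assms len)
  then have PQ: "det ?P * det ?Q = 1"
    using det_mult[OF car(1,2)] by simp
  have "?P * labelled_mat ys ys f * ?Q = labelled_mat xs xs f"
    unfolding labelled_mat_mult[OF assms(2)]
    by (intro labelled_mat_cong) (simp add: assms sum_delta_mult)
  then have "det (labelled_mat xs xs f) = det (?P * labelled_mat ys ys f * ?Q)" by simp
  also have "\<dots> = det ?P * det (labelled_mat ys ys f) * det ?Q"
    using det_mult[OF car(4,2)] det_mult[OF car(1,3)] by simp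
  also have "\<dots> = det (labelled_mat ys ys f) * (det ?P * det ?Q)"
    by (simp add: ac_simps)
  finally show ?thesis by (simp add: PQ)
qed

text \<open>\<open>W\<close> plays the role of \<open>D\<^sup>-\<^sup>1 C\<close>, with \<open>C\<close> and \<open>D\<close> the lower blocks, so \<open>D\<close> need not be inverted.\<close>

lemma det_labelled_mat_schur:
  fixes f :: "'a \<Rightarrow> 'a \<Rightarrow> 'd :: idom"
  assumes "distinct xs" "distinct ys"
    and W: "\<And>y x. y \<in> set ys \<Longrightarrow> x \<in> set xs \<Longrightarrow> (\<Sum>y'\<in>set ys. f y y' * W y' x) = f y x"
  shows "det (labelled_mat (xs @ ys) (xs @ ys) f) =
    det (labelled_mat xs xs (\<lambda>x x'. f x x' - (\<Sum>y\<in>set ys. f x y * W y x'))) *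
    det (labelled_mat ys ys f)"
proof -
  let ?m = "length xs" and ?n = "length ys"
  let ?d = "\<lambda>x y :: 'a. if x = y then 1 else 0 :: 'd"
  let ?A = "labelled_mat xs xs f" and ?B = "labelled_mat xs ys f"
  let ?C = "labelled_mat ys xs f" and ?D = "labelled_mat ys ys f"
  let ?I = "labelled_mat xs xs ?d" and ?J = "labelled_mat ys ys ?d"
  let ?Z = "labelled_mat xs ys (\<lambda>_ _. 0 :: 'd)"
  let ?W = "labelled_mat ys xs (\<lambda>y x. - W y x)"
  let ?S = "labelled_mat xs xs (\<lambda>x x'. f x x' - (\<Sum>y\<in>set ys. f x y * W y x'))"
  \<comment> \<open>Multiplying by the unitriangular \<open>?T\<close> performs column operations
    that clear the lower left block \<open>?C\<close> and leave the Schur complement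
    \<open>?S\<close> at the upper left.\<close>
  let ?M = "four_block_mat ?A ?B ?C ?D" and ?T = "four_block_mat ?I ?Z ?W ?J"
  have A: "?A * ?I + ?B * ?W = ?S"
    unfolding labelled_mat_mult[OF assms(1)] labelled_mat_mult[OF assms(2)] labelled_mat_add
    by (intro labelled_mat_cong)
      (simp add: assms sum_negf sum_delta_mult)
  have B: "?A * ?Z + ?B * ?J = ?B"
    unfolding labelled_mat_mult[OF assms(1)] labelled_mat_mult[OF assms(2)] labelled_mat_add
    by (intro labelled_mat_cong) (simp add: sum_delta_mult)
  have C: "?C * ?I + ?D * ?W = 0\<^sub>m ?n ?m"
    unfolding labelled_mat_mult[OF assms(1)] labelled_mat_mult[OF assms(2)] labelled_mat_add
      labelled_mat_zero[symmetric]
    by (intro labelled_mat_cong)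
      (simp add: sum_negf W sum_delta_mult)
  have D: "?C * ?Z + ?D * ?J = ?D"
    unfolding labelled_mat_mult[OF assms(1)] labelled_mat_mult[OF assms(2)] labelled_mat_add
    by (intro labelled_mat_cong) (simp add: sum_delta_mult)
  have "?M * ?T = four_block_mat ?S ?B (0\<^sub>m ?n ?m) ?D"
    by (subst mult_four_block_mat[where ?nr1.0 = ?m and ?nr2.0 = ?n and ?n1.0 = ?m and ?n2.0 = ?n
          and ?nc1.0 = ?m and ?nc2.0 = ?n]) (simp_all only: labelled_mat_carrier A B C D)
  then have "det (?M * ?T) = det ?S * det ?D"
    by (simp add: det_four_block_mat_lower_left_zero[of _ ?m _ ?n])
  moreover have "det ?T = 1"
    using assms
    by (subst det_four_block_mat_upper_right_zero[of _ ?m _ ?n])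
      (auto simp: labelled_mat_zero labelled_mat_one)
  moreover have "det (?M * ?T) = det ?M * det ?T"
    by (rule det_mult[of _ "?m + ?n"]) auto
  ultimately show ?thesis
    by (simp add: labelled_mat_append)
qed

text \<open>A vanishing lower left block is solved by \<open>W = 0\<close>, and the Schur complement
  is then the upper left block itself.\<close>

lemma det_labelled_mat_block_triangular:
  fixes f :: "'a \<Rightarrow> 'a \<Rightarrow> 'd :: idom"
  assumes "distinct xs" "distinct ys"
    and "\<And>y x. y \<in> set ys \<Longrightarrow> x \<in> set xs \<Longrightarrow> f y x = 0"
  shows "det (labelled_mat (xs @ ys) (xs @ ys) f) =
    det (labelled_mat xs xs f) * det (labelled_mat ys ys f)"
  using det_labelled_mat_schur[OF assms(1,2), of f "\<lambda>_ _. 0"] assms(3) by simp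

text \<open>Induction on \<open>xs\<close>, splitting off the first block by the triangular case. It
  serves for the disjoint copies of the second graph, one block per vertex of the first.\<close>

lemma det_labelled_mat_concat:
  fixes f :: "'b \<Rightarrow> 'b \<Rightarrow> 'd :: idom"
  assumes "distinct (concat (map h xs))" "distinct xs"
    and "\<And>x x' y y'. x \<in> set xs \<Longrightarrow> x' \<in> set xs \<Longrightarrow> x \<noteq> x' \<Longrightarrow> y \<in> set (h x) \<Longrightarrow> y' \<in> set (h x')
      \<Longrightarrow> f y y' = 0"
  shows "det (labelled_mat (concat (map h xs)) (concat (map h xs)) f) =
    (\<Prod>x\<leftarrow>xs. det (labelled_mat (h x) (h x) f))"
  using assms
proof (induction xs)
  case Nil
  show ?case using labelled_mat_carrier[of "[]" "[]" f] by simp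
next
  case (Cons x xs)
  have IH: "det (labelled_mat (concat (map h xs)) (concat (map h xs)) f) =
    (\<Prod>x\<leftarrow>xs. det (labelled_mat (h x) (h x) f))"
    using Cons.prems by (intro Cons.IH) auto
  have z: "f y y' = 0" if "y \<in> set (concat (map h xs))" "y' \<in> set (h x)" for y y'
  proof -
    from that(1) obtain x' where "x' \<in> set xs" "y \<in> set (h x')" by auto
    then show ?thesis using that(2) Cons.prems(2) by (intro Cons.prems(3)[of x' x]) auto
  qed
  have "det (labelled_mat (h x @ concat (map h xs)) (h x @ concat (map h xs)) f) =
    det (labelled_mat (h x) (h x) f) * det (labelled_mat (concat (map h xs)) (concat (map h xs)) f)"
    using Cons.prems z by (intro det_labelled_mat_block_triangular) auto
  then show ?case by (simp add: IH)
qed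

lemma det_labelled_mat_scalar:
  fixes c :: "'d :: comm_ring_1"
  assumes "distinct xs"
  shows "det (labelled_mat xs xs (\<lambda>x y. if x = y then c else 0)) = c ^ length xs"
proof -
  have "labelled_mat xs xs (\<lambda>x y. if x = y then c else 0) = c \<cdot>\<^sub>m 1\<^sub>m (length xs)"
    unfolding labelled_mat_one[OF assms, symmetric] labelled_mat_smult
    by (intro labelled_mat_cong) auto
  then show ?thesis by simp
qed

section \<open>Spectra of real symmetric matrices\<close>

text \<open>The Hermitian form \<open>?S\<close> of an eigenvector \<open>v\<close> equals
  \<open>k\<close> times the squared norm \<open>?N\<close> of \<open>v\<close>. Conjugation only
  swaps the two summation indices, so by symmetry \<open>?S\<close> is real, and \<open>?N\<close>
  can be cancelled.\<close>

lemma eigenvalue_symmetric_real: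
  fixes A :: "real mat"
  assumes A: "A \<in> carrier_mat n n" and sym: "transpose_mat A = A"
    and ev: "eigenvalue (map_mat complex_of_real A) k"
  shows "k \<in> \<real>"
proof -
  from ev A obtain v where v: "v \<in> carrier_vec n" "v \<noteq> 0\<^sub>v n"
    and eq: "map_mat complex_of_real A *\<^sub>v v = k \<cdot>\<^sub>v v"
    unfolding eigenvalue_def eigenvector_def by auto
  let ?a = "\<lambda>i j. complex_of_real (A $$ (i, j))"
  let ?S = "\<Sum>i<n. \<Sum>j<n. cnj (v $ i) * ?a i j * v $ j"
  let ?N = "\<Sum>i<n. (cmod (v $ i))\<^sup>2"
  have row: "(\<Sum>j<n. ?a i j * v $ j) = k * v $ i" if "i < n" for i
    using arg_cong[OF eq, of "\<lambda>w. vec_index w i"] that A v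
    by (simp add: scalar_prod_def atLeast0LessThan)
  have symA: "A $$ (i, j) = A $$ (j, i)" if "i < n" "j < n" for i j
    using arg_cong[OF sym, of "\<lambda>M. M $$ (i, j)"] that A by simp
  have "?S = (\<Sum>i<n. cnj (v $ i) * (\<Sum>j<n. ?a i j * v $ j))"
    by (simp add: sum_distrib_left mult.assoc)
  also have "\<dots> = (\<Sum>i<n. k * (v $ i * cnj (v $ i)))"
    by (intro sum.cong) (simp_all add: row)
  also have "\<dots> = k * complex_of_real ?N"
    by (simp only: sum_distrib_left of_real_sum complex_norm_square)
  finally have S: "?S = k * complex_of_real ?N" .
  have "cnj ?S = (\<Sum>i<n. \<Sum>j<n. cnj (v $ j) * ?a i j * v $ i)"
    by (simp add: mult_ac)
  also have "\<dots> = (\<Sum>i<n. \<Sum>j<n. cnj (v $ j) * ?a j i * v $ i)"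
    by (intro sum.cong refl) (simp add: symA)
  also have "\<dots> = ?S"
    by (rule sum.swap)
  finally have cS: "cnj ?S = ?S" .
  have "?N \<noteq> 0"
  proof
    assume "?N = 0"
    then have "\<forall>i<n. v $ i = 0"
      by (subst (asm) sum_nonneg_eq_0_iff) auto
    then have "v = 0\<^sub>v n" using v by (intro eq_vecI) auto
    with v show False by simp
  qed
  moreover have "cnj k * complex_of_real ?N = k * complex_of_real ?N"
    using cS unfolding S by simp
  ultimately have "cnj k = k" by (metis mult_cancel_right of_real_eq_0_iff)
  then show ?thesis by (simp add: Reals_cnj_iff)
qed

text \<open>The polynomial splits over the complex numbers and all its roots there are real.
  Injectivity of the coefficientwise embedding brings the factorization back to the reals.\<close>

lemma char_poly_symmetric_splits:
  fixes A :: "real mat"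
  assumes A: "A \<in> carrier_mat n n" and sym: "transpose_mat A = A"
  obtains as where "length as = n" "char_poly A = (\<Prod>a\<leftarrow>as. [:- a, 1:])"
proof -
  let ?C = "map_mat complex_of_real A"
  have C: "?C \<in> carrier_mat n n" using A by simp
  obtain bs where bs: "char_poly ?C = (\<Prod>a\<leftarrow>bs. [:- a, 1:])" "length bs = n"
    using char_poly_factorized[OF C] by blast
  have real: "complex_of_real (Re b) = b" if "b \<in> set bs" for b
  proof -
    have "poly (char_poly ?C) b = 0"
      unfolding bs(1) using that by (rule linear_poly_root)
    then have "b \<in> \<real>"
      using eigenvalue_symmetric_real[OF A sym] eigenvalue_root_char_poly[OF C] by simp
    then show ?thesis by (rule of_real_Re)
  qed
  interpret ph: map_poly_inj_comm_ring_hom complex_of_real ..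
  have "map_poly complex_of_real (char_poly A) = (\<Prod>a\<leftarrow>bs. [:- a, 1:])"
    using of_real_hom.char_poly_hom[OF A, where 'a = complex] bs by simp
  also have "\<dots> = (\<Prod>b\<leftarrow>bs. map_poly complex_of_real [:- Re b, 1:])"
    using real by (intro arg_cong[where f = prod_list] map_cong) auto
  also have "\<dots> = map_poly complex_of_real (\<Prod>b\<leftarrow>bs. [:- Re b, 1:])"
    by (simp add: ph.hom_prod_list o_def)
  finally have "char_poly A = (\<Prod>a\<leftarrow>map Re bs. [:- a, 1:])"
    by (simp add: o_def)
  then show ?thesis using bs(2) that[of "map Re bs"] by simp
qed

text \<open>Both sides are the split characteristic polynomial, with coefficients mapped by
  \<open>h\<close>, evaluated at \<open>c\<close>. The map \<open>h\<close> carries the real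
  eigenvalues into a field where \<open>c\<close> may involve the coronal.\<close>

lemma prod_nth_eigenvalue:
  fixes A :: "real mat" and h :: "real \<Rightarrow> 'f :: field"
  assumes h: "comm_ring_hom h" and A: "A \<in> carrier_mat n n" and sym: "transpose_mat A = A"
  shows "(\<Prod>i = 1..n. c - h (nth_eigenvalue A i)) = det (c \<cdot>\<^sub>m 1\<^sub>m n - map_mat h A)"
proof -
  interpret comm_ring_hom h by fact
  interpret ph: map_poly_comm_ring_hom h ..
  obtain as where as: "length as = n" "char_poly A = (\<Prod>a\<leftarrow>as. [:- a, 1:])"
    using char_poly_symmetric_splits[OF A sym] .
  have "proots (\<Prod>a\<leftarrow>bs. [:- a, 1:]) = mset bs" for bs :: "real list"
  proof (induction bs)
    case (Cons b bs)
    have "(\<Prod>a\<leftarrow>bs. [:- a, 1:]) \<noteq> 0" by (auto simp: prod_list_zero_iff)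
    then show ?case using Cons.IH by (simp add: proots_mult del: mult_pCons_left)
  qed simp
  then have "proots (char_poly A) = mset as"
    by (simp only: as(2))
  then obtain l where l: "l = rev (sorted_list_of_multiset (proots (char_poly A)))"
    and mset_l: "mset l = mset as" by simp
  have len: "length l = n" using mset_l as(1) by (metis size_mset)
  \<comment> \<open>\<open>nth_eigenvalue\<close> counts from 1, list positions from 0. The product
    depends on \<open>l\<close> only through its multiset, so the sorted roots can be traded for
    \<open>as\<close>.\<close>
  have "(\<Prod>i = 1..n. c - h (nth_eigenvalue A i)) = (\<Prod>i<n. c - h (l ! i))"
    unfolding nth_eigenvalue_def l[symmetric]
    by (rule prod.reindex_bij_witness[of _ Suc "\<lambda>i. i - 1"]) auto
  also have "\<dots> = prod_list (map (\<lambda>a. c - h a) l)"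
    using len by (simp add: prod.list_conv_set_nth atLeast0LessThan)
  also have "\<dots> = prod_mset (image_mset (\<lambda>a. c - h a) (mset l))"
    by (simp flip: prod_mset_prod_list)
  also have "\<dots> = prod_list (map (\<lambda>a. c - h a) as)"
    unfolding mset_l by (simp flip: prod_mset_prod_list)
  also have "\<dots> = poly (map_poly h (char_poly A)) c"
    unfolding as(2) by (simp add: ph.hom_prod_list poly_prod_list o_def hom_uminus)
  also have "\<dots> = poly (char_poly (map_mat h A)) c"
    by (simp add: char_poly_hom[OF A])
  also have "\<dots> = det (- char_matrix (map_mat h A) c)"
    using A by (intro char_poly_matrix[of _ n]) simp
  also have "- char_matrix (map_mat h A) c = c \<cdot>\<^sub>m 1\<^sub>m n - map_mat h A"
    using A by (intro eq_matI) (auto simp: char_matrix_def)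
  finally show ?thesis .
qed

section \<open>Characteristic matrices and coronals over the rational functions\<close>

lemma comm_ring_hom_ratfun_const: "comm_ring_hom ratfun_const"
  by unfold_locales (simp_all add: ratfun_const_def flip: to_fract_add to_fract_mult one_pCons)

lemma comm_ring_hom_to_fract: "comm_ring_hom (to_fract :: 'a :: idom \<Rightarrow> 'a fract)"
  by unfold_locales simp_all

lemma ratfun_X_nonzero [simp]: "ratfun_X \<noteq> 0"
  by (simp add: ratfun_X_def)

text \<open>\<open>to_fract\<close> is a ring homomorphism and so commutes with determinants. The
  result is the determinant of the very matrix that \<open>coronal\<close> inverts.\<close>

lemma to_fract_char_poly:
  assumes A: "A \<in> carrier_mat n n"
  shows "to_fract (char_poly A) = det (ratfun_X \<cdot>\<^sub>m 1\<^sub>m n - map_mat ratfun_const A)"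
proof -
  have "map_mat to_fract (char_poly_matrix A) = ratfun_X \<cdot>\<^sub>m 1\<^sub>m n - map_mat ratfun_const A"
    using A
    by (intro eq_matI)
      (auto simp: char_poly_matrix_def ratfun_X_def ratfun_const_def simp flip: to_fract_diff to_fract_uminus)
  then show ?thesis
    by (simp add: char_poly_def comm_ring_hom.hom_det[OF comm_ring_hom_to_fract, symmetric])
qed

text \<open>The function \<open>u\<close> lists the row sums of the inverse of
  \<open>xI - A\<close>. Keeping only the linear system that it solves lets later steps avoid the
  inverse matrix.\<close>

lemma coronal_eq_sum:
  assumes "distinct vs"
    and A: "labelled_mat vs vs f = ratfun_X \<cdot>\<^sub>m 1\<^sub>m (length vs) - map_mat ratfun_const A"
    and dim: "A \<in> carrier_mat (length vs) (length vs)"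
  obtains u where "coronal A = sum u (set vs)"
    and "\<And>w. w \<in> set vs \<Longrightarrow> (\<Sum>w'\<in>set vs. f w w' * u w') = 1"
proof -
  let ?n = "length vs" and ?B = "labelled_mat vs vs f"
  let ?one = "vec (length vs) (\<lambda>_. 1 :: ratfun)"
  have B: "?B \<in> carrier_mat ?n ?n" by simp
  \<comment> \<open>The determinant is the image of a monic, hence nonzero, polynomial.\<close>
  have "det ?B \<noteq> 0"
    using degree_monic_char_poly[OF dim] unfolding A to_fract_char_poly[OF dim, symmetric] by auto
  then have unit: "?B \<in> Units (ring_mat TYPE(ratfun) ?n ())"
    by (rule det_non_zero_imp_unit[OF B])
  then obtain B' where inv: "mat_inverse ?B = Some B'"
    using mat_inverse(1)[OF B, of "()"] by (cases "mat_inverse ?B") auto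
  from mat_inverse(2)[OF B inv] have B': "?B * B' = 1\<^sub>m ?n" "B' \<in> carrier_mat ?n ?n" by auto
  define z where "z = B' *\<^sub>v ?one"
  have z: "z \<in> carrier_vec ?n" using B' by (simp add: z_def carrier_vecI)
  have Bz: "?B *\<^sub>v z = ?one"
    using B' B unfolding z_def by (subst assoc_mult_mat_vec[symmetric, of _ ?n ?n _ ?n]) auto
  \<comment> \<open>The vector \<open>z\<close> becomes a function of labels; distinctness of
    \<open>vs\<close> makes the position of each label unique.\<close>
  define u where "u w = z $ (THE i. i < ?n \<and> vs ! i = w)" for w
  have u: "u (vs ! i) = z $ i" if "i < ?n" for i
    unfolding u_def using that assms(1)
    by (intro arg_cong[where f = "vec_index z"] the_equality) (auto simp: nth_eq_iff_index_eq)
  have "coronal A = ?one \<bullet> z"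
    using dim inv by (simp add: coronal_def Let_def z_def A carrier_matD)
  also have "\<dots> = (\<Sum>i = 0..<?n. u (vs ! i))"
    using z by (simp add: scalar_prod_def u)
  finally have "coronal A = sum u (set vs)"
    by (simp add: sum_nth_distinct[OF assms(1)])
  moreover have "(\<Sum>w'\<in>set vs. f w w' * u w') = 1" if w: "w \<in> set vs" for w
  proof -
    obtain i where i: "i < ?n" "w = vs ! i" using w by (auto simp: in_set_conv_nth)
    have "(\<Sum>w'\<in>set vs. f w w' * u w') = (\<Sum>j = 0..<?n. f (vs ! i) (vs ! j) * u (vs ! j))"
      by (simp add: i sum_nth_distinct[OF assms(1), of "\<lambda>w'. f (vs ! i) w' * u w'"])
    also have "\<dots> = (?B *\<^sub>v z) $ i"
      using i z by (simp add: scalar_prod_def u)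
    finally show ?thesis using i by (simp add: Bz)
  qed
  ultimately show ?thesis by (rule that)
qed

section \<open>Characteristic matrices of graphs\<close>

text \<open>The entry of \<open>cI - A(G)\<close>. The scalar \<open>c\<close> is kept general: it
  is \<open>x\<close> for the corona and the second graph, but the argument of the eigenvalue
  product for the first graph.\<close>

definition char_entry :: "ratfun \<Rightarrow> 'a pair_pre_digraph \<Rightarrow> 'a \<Rightarrow> 'a \<Rightarrow> ratfun" where
  "char_entry c G u v = (if u = v then c else 0) - (if (u, v) \<in> parcs G then 1 else 0)"

lemma adjacency_matrix_carrier: "adjacency_matrix G vs \<in> carrier_mat (length vs) (length vs)"
  by (simp add: adjacency_matrix_def)

lemma labelled_mat_char_entry:
  assumes "distinct vs"
  shows "labelled_mat vs vs (char_entry c G) =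
    c \<cdot>\<^sub>m 1\<^sub>m (length vs) - map_mat ratfun_const (adjacency_matrix G vs)"
  using assms
  by (intro eq_matI)
    (auto simp: char_entry_def adjacency_matrix_def nth_eq_iff_index_eq ratfun_const_def
      simp flip: one_pCons)

lemma to_fract_char_poly_adjacency_matrix:
  assumes "distinct vs"
  shows "to_fract (char_poly (adjacency_matrix G vs)) =
    det (labelled_mat vs vs (char_entry ratfun_X G))"
  by (simp add: to_fract_char_poly[OF adjacency_matrix_carrier] labelled_mat_char_entry[OF assms])

lemma transpose_adjacency_matrix:
  assumes "pair_graph G"
  shows "transpose_mat (adjacency_matrix G vs) = adjacency_matrix G vs"
proof -
  interpret pair_graph G by fact
  have "(u, v) \<in> parcs G \<longleftrightarrow> (v, u) \<in> parcs G" for u v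
    using pair_sym_arcs by (auto simp: symmetric_def dest: symD)
  then show ?thesis
    by (intro eq_matI) (auto simp: adjacency_matrix_def)
qed

section \<open>Edges, degrees and the incidence matrix\<close>

lemma doubleton_in_uedges_iff:
  assumes "pair_graph G"
  shows "{u, v} \<in> uedges G \<longleftrightarrow> (u, v) \<in> parcs G"
proof -
  interpret pair_graph G by fact
  have "(u, v) \<in> parcs G \<longleftrightarrow> (v, u) \<in> parcs G" for u v
    using pair_sym_arcs by (auto simp: symmetric_def dest: symD)
  then show ?thesis
    by (force simp: uedges_def doubleton_eq_iff)
qed

text \<open>Absence of loops makes the two ends distinct, and symmetry lets the arc be directed away
  from \<open>u\<close>.\<close>

lemma uedge_containing:
  assumes "pair_graph G" "e \<in> uedges G" "u \<in> e"
  obtains v where "e = {u, v}" "u \<noteq> v" "(u, v) \<in> parcs G"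
proof -
  interpret pair_graph G by fact
  from assms(2) obtain a b where ab: "(a, b) \<in> parcs G" "e = {a, b}"
    by (auto simp: uedges_def)
  then have "a \<noteq> b" using pair_no_loops by fastforce
  then obtain v where "e = {u, v}" "u \<noteq> v" using ab assms(3) by auto
  then show ?thesis
    using that assms(2) doubleton_in_uedges_iff[OF assms(1)] by blast
qed

text \<open>Forgetting direction maps the arcs leaving \<open>u\<close> bijectively onto the edges
  at \<open>u\<close>: with the tail fixed, the edge determines the head.\<close>

lemma card_uedges_containing:
  assumes "pair_graph G"
  shows "card {e \<in> uedges G. u \<in> e} = out_degree (with_proj G) u"
proof -
  have "bij_betw (\<lambda>(a, b). {a, b}) (out_arcs (with_proj G) u) {e \<in> uedges G. u \<in> e}"
  proof (rule bij_betwI')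
    fix p q assume "p \<in> out_arcs (with_proj G) u" "q \<in> out_arcs (with_proj G) u"
    then show "(case p of (a, b) \<Rightarrow> {a, b}) = (case q of (a, b) \<Rightarrow> {a, b}) \<longleftrightarrow> p = q"
      by (cases p; cases q) (auto simp: out_arcs_def doubleton_eq_iff)
  next
    fix p assume "p \<in> out_arcs (with_proj G) u"
    then show "(case p of (a, b) \<Rightarrow> {a, b}) \<in> {e \<in> uedges G. u \<in> e}"
      by (auto simp: out_arcs_def uedges_def)
  next
    fix e assume "e \<in> {e \<in> uedges G. u \<in> e}"
    then obtain v where "e = {u, v}" "(u, v) \<in> parcs G"
      using uedge_containing[OF assms] by blast
    then show "\<exists>p\<in>out_arcs (with_proj G) u. e = (case p of (a, b) \<Rightarrow> {a, b})"
      by (intro bexI[of _ "(u, v)"]) (auto simp: out_arcs_def)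
  qed
  then show ?thesis
    unfolding out_degree_def by (simp add: bij_betw_same_card)
qed

text \<open>The entry at \<open>(u, v)\<close> of \<open>R R^T\<close>, for \<open>R\<close> the
  incidence matrix. On the diagonal it counts the edges at \<open>u\<close>; off the diagonal two
  vertices share an edge exactly when they are adjacent, and then only one.\<close>

lemma incidence_gram:
  assumes "pair_graph G" "regular_graph r G" "u \<in> pverts G"
  shows "(\<Sum>e\<in>uedges G. if u \<in> e \<and> v \<in> e then 1 else 0 :: 'r :: comm_ring_1) =
    (if u = v then of_nat r else 0) + (if (u, v) \<in> parcs G then 1 else 0)"
proof -
  interpret pair_graph G by fact
  have no_loop: "(u, u) \<notin> parcs G" using pair_no_loops by fastforce
  have card: "(\<Sum>e\<in>uedges G. if u \<in> e \<and> v \<in> e then 1 else 0 :: 'r) =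
    of_nat (card {e \<in> uedges G. u \<in> e \<and> v \<in> e})"
    using finite_uedges[OF assms(1)] by (simp add: sum.If_cases Int_def)
  show ?thesis
  proof (cases "u = v")
    case True
    then show ?thesis
      using card card_uedges_containing[OF assms(1), of u] assms(2,3) no_loop
      by (simp add: regular_graph_def)
  next
    case False
    have "{e \<in> uedges G. u \<in> e \<and> v \<in> e} = (if (u, v) \<in> parcs G then {{u, v}} else {})"
      using False doubleton_in_uedges_iff[OF assms(1), of u v] uedge_containing[OF assms(1), of _ u]
      by (auto split: if_splits)
    then show ?thesis using card False by simp
  qed
qed

section \<open>The characteristic polynomial of the corona\<close>

theorem theorem2p1:
  fixes G1 :: "'a pair_pre_digraph" and G2 :: "'b pair_pre_digraph"
    and r1 n1 m1 :: nat
    and vs1 :: "'a list" and vs2 :: "'b list" and vs :: "('a, 'b) corona_vertex list"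
  assumes "pair_graph G1" and "pair_graph G2"
    and "regular_graph r1 G1"
    and "card (pverts G1) = n1" and "card (uedges G1) = m1"
    and "vertex_enumeration G1 vs1" and "vertex_enumeration G2 vs2"
    and "vertex_enumeration (subdivision_vertex_corona G1 G2) vs"
  shows "to_fract (char_poly (adjacency_matrix (subdivision_vertex_corona G1 G2) vs)) =
           ratfun_X powi (int m1 - int n1)
           * to_fract (char_poly (adjacency_matrix G2 vs2)) ^ n1
           * (\<Prod>i = 1..n1. ratfun_X ^ 2 - coronal (adjacency_matrix G2 vs2) * ratfun_X
                - of_nat r1 - ratfun_const (nth_eigenvalue (adjacency_matrix G1 vs1) i))"
proof -
  let ?C = "subdivision_vertex_corona G1 G2"
  let ?f = "char_entry ratfun_X ?C" and ?g = "char_entry ratfun_X G2"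
  let ?\<Gamma> = "coronal (adjacency_matrix G2 vs2)"
  have vs1: "distinct vs1" "set vs1 = pverts G1" and vs2: "distinct vs2" "set vs2 = pverts G2"
    and vs: "distinct vs" "set vs = pverts ?C"
    using assms(6-8) by (auto simp: vertex_enumeration_def)
  have n1: "length vs1 = n1" using vs1 assms(4) by (metis distinct_card)
  obtain es where es: "distinct es" "set es = uedges G1"
    using finite_distinct_list[OF finite_uedges[OF assms(1)]] by blast
  have m1: "length es = m1" using es assms(5) by (metis distinct_card)
  obtain u where u: "?\<Gamma> = sum u (pverts G2)"
    "\<And>w. w \<in> pverts G2 \<Longrightarrow> (\<Sum>w'\<in>pverts G2. ?g w w' * u w') = 1"
    using coronal_eq_sum[OF vs2(1) labelled_mat_char_entry[OF vs2(1)] adjacency_matrix_carrier]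
    unfolding vs2(2) by metis

  define xs where "xs = map (\<lambda>v. Sub (Orig v) :: ('a, 'b) corona_vertex) vs1"
  define ms where "ms = map (\<lambda>e. Sub (Mid e) :: ('a, 'b) corona_vertex) es"
  \<comment> \<open>Listing the copies one after another makes their part of the matrix block
    diagonal.\<close>
  define cs where "cs = concat (map (\<lambda>v. map (Copy v) vs2) vs1)"
  have dist: "distinct xs" "distinct ms"
    using vs1 es by (auto simp: xs_def ms_def distinct_map inj_on_def)
  have dist_cs: "distinct (concat (map (\<lambda>v. map (Copy v) vs2) us))" if "distinct us" for us :: "'a list"
    using that vs2(1) by (induction us) (auto simp: distinct_map inj_on_def)
  have set: "set xs = (\<lambda>v. Sub (Orig v)) ` pverts G1" "set ms = (\<lambda>e. Sub (Mid e)) ` uedges G1"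
    "set cs = (\<lambda>(v, w). Copy v w) ` (pverts G1 \<times> pverts G2)"
    using vs1 vs2 es by (auto simp: xs_def ms_def cs_def)
  have dist_ys: "distinct (ms @ cs)" and dist_all: "distinct (xs @ ms @ cs)"
    using dist dist_cs[OF vs1(1)] set by (auto simp: cs_def[symmetric])
  have set_all: "set (xs @ ms @ cs) = set vs"
    unfolding vs set_append set by (auto simp: subdivision_vertex_corona_def subdivision_graph_def)
  have fin: "finite (uedges G1)" "finite (pverts G1)" "finite (pverts G2)"
    using finite_uedges[OF assms(1)] vs1(2) vs2(2) by (auto simp flip: vs1(2) vs2(2))

  note corona = char_entry_def subdivision_vertex_corona_def subdivision_graph_def
  have f [simp]:
    "\<And>a b. ?f (Sub (Orig a)) (Sub (Orig b)) = (if a = b then ratfun_X else 0)"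
    "\<And>a e. ?f (Sub (Orig a)) (Sub (Mid e)) = (if e \<in> uedges G1 \<and> a \<in> e then - 1 else 0)"
    "\<And>a e. ?f (Sub (Mid e)) (Sub (Orig a)) = (if e \<in> uedges G1 \<and> a \<in> e then - 1 else 0)"
    "\<And>e e'. ?f (Sub (Mid e)) (Sub (Mid e')) = (if e = e' then ratfun_X else 0)"
    "\<And>e v w. ?f (Sub (Mid e)) (Copy v w) = 0"
    "\<And>e v w. ?f (Copy v w) (Sub (Mid e)) = 0"
    "\<And>a v w. ?f (Sub (Orig a)) (Copy v w) =
      (if a = v \<and> v \<in> pverts G1 \<and> w \<in> pverts G2 then - 1 else 0)"
    "\<And>a v w. ?f (Copy v w) (Sub (Orig a)) =
      (if a = v \<and> v \<in> pverts G1 \<and> w \<in> pverts G2 then - 1 else 0)"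
    "\<And>v w v' w'. v \<in> pverts G1 \<Longrightarrow> ?f (Copy v w) (Copy v' w') = (if v = v' then ?g w w' else 0)"
    by (auto simp: corona)
  have sum_ys: "sum F (set (ms @ cs)) =
    (\<Sum>e\<in>uedges G1. F (Sub (Mid e))) + (\<Sum>v\<in>pverts G1. \<Sum>w\<in>pverts G2. F (Copy v w))"
    for F :: "('a, 'b) corona_vertex \<Rightarrow> ratfun"
  proof -
    have "sum F (set (ms @ cs)) = sum F (set ms) + sum F (set cs)"
      unfolding set_append by (rule sum.union_disjoint) (auto simp: set fin)
    moreover have "sum F (set ms) = (\<Sum>e\<in>uedges G1. F (Sub (Mid e)))"
      unfolding set by (subst sum.reindex) (auto simp: inj_on_def)
    moreover have "sum F (set cs) = (\<Sum>(v, w)\<in>pverts G1 \<times> pverts G2. F (Copy v w))"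
      unfolding set by (subst sum.reindex) (auto simp: inj_on_def intro!: sum.cong)
    ultimately show ?thesis by (simp add: sum.cartesian_product)
  qed

  \<comment> \<open>The solution of \<open>D W = C\<close> read off blockwise: on midpoints
    \<open>D\<close> is \<open>xI\<close>, so \<open>C\<close> is divided by \<open>x\<close>; on a
    copy \<open>D\<close> is \<open>xI - A(G2)\<close> and the nonzero column of \<open>C\<close> is
    constantly -1, so \<open>- u\<close> solves the system.\<close>
  define W :: "('a, 'b) corona_vertex \<Rightarrow> ('a, 'b) corona_vertex \<Rightarrow> ratfun" where
    "W y x = (case y of Sub s \<Rightarrow> ?f y x / ratfun_X
       | Copy v w \<Rightarrow> if x = Sub (Orig v) then - u w else 0)" for y x
  have W: "(\<Sum>y'\<in>set (ms @ cs). ?f y y' * W y' x) = ?f y x"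
    if y: "y \<in> set (ms @ cs)" and x: "x \<in> set xs" for y x
  proof -
    obtain a where a: "x = Sub (Orig a)" "a \<in> pverts G1" using x by (auto simp: set)
    consider e where "y = Sub (Mid e)" "e \<in> uedges G1"
      | v w where "y = Copy v w" "v \<in> pverts G1" "w \<in> pverts G2"
      using y by (auto simp: set)
    then show ?thesis
    proof cases
      case 1
      have "(\<Sum>e'\<in>uedges G1. ?f y (Sub (Mid e')) * W (Sub (Mid e')) x) =
        (\<Sum>e'\<in>uedges G1. if e = e' then ?f y x else 0)"
        by (intro sum.cong) (auto simp: 1 W_def)
      then show ?thesis
        unfolding sum_ys using 1 fin by simp
    next
      case 2
      \<comment> \<open>A row of \<open>D\<close> in copy \<open>v\<close> meets no other copy, and
        by \<open>u(2)\<close> the remaining sum is 1. This leaves -1 or 0, the entry of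
        \<open>C\<close>.\<close>
      have "(\<Sum>w'\<in>pverts G2. ?f y (Copy v' w') * W (Copy v' w') x) =
        (if v = v' then (if v = a then - (\<Sum>w'\<in>pverts G2. ?g w w' * u w') else 0) else 0)" for v'
        using 2 by (auto simp: W_def a sum_negf)
      then show ?thesis
        unfolding sum_ys using 2 fin a by (simp add: u(2))
    qed
  qed

  \<comment> \<open>The Schur complement is \<open>(x - Gamma - r1 / x) I - A(G1) / x\<close>, with
    Gamma the coronal; taking out the factor \<open>1 / x\<close> turns the scalar into
    \<open>?c\<close>.\<close>
  let ?c = "ratfun_X ^ 2 - ?\<Gamma> * ratfun_X - of_nat r1"
  have S: "?f (Sub (Orig a)) (Sub (Orig b)) - (\<Sum>y\<in>set (ms @ cs). ?f (Sub (Orig a)) y * W y (Sub (Orig b)))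
    = inverse ratfun_X * char_entry ?c G1 a b"
    if ab: "a \<in> pverts G1" "b \<in> pverts G1" for a b
  proof -
    have "(\<Sum>e\<in>uedges G1. ?f (Sub (Orig a)) (Sub (Mid e)) * W (Sub (Mid e)) (Sub (Orig b))) =
      (\<Sum>e\<in>uedges G1. (if a \<in> e \<and> b \<in> e then 1 else 0) * inverse ratfun_X)"
      by (intro sum.cong) (auto simp: W_def field_simps)
    also have "\<dots> = ((if a = b then of_nat r1 else 0) + (if (a, b) \<in> parcs G1 then 1 else 0)) * inverse ratfun_X"
      unfolding sum_distrib_right[symmetric] incidence_gram[OF assms(1,3) ab(1)] ..
    finally have mid: "(\<Sum>e\<in>uedges G1. ?f (Sub (Orig a)) (Sub (Mid e)) * W (Sub (Mid e)) (Sub (Orig b))) =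
      ((if a = b then of_nat r1 else 0) + (if (a, b) \<in> parcs G1 then 1 else 0)) * inverse ratfun_X" .
    \<comment> \<open>Both factors carry a minus sign, so the entries of \<open>u\<close> add up to
      the coronal.\<close>
    have "(\<Sum>w\<in>pverts G2. ?f (Sub (Orig a)) (Copy v w) * W (Copy v w) (Sub (Orig b))) =
      (if a = v then (if a = b then ?\<Gamma> else 0) else 0)" if "v \<in> pverts G1" for v
      using that by (auto simp: W_def u(1))
    then have copies: "(\<Sum>v\<in>pverts G1. \<Sum>w\<in>pverts G2.
        ?f (Sub (Orig a)) (Copy v w) * W (Copy v w) (Sub (Orig b))) = (if a = b then ?\<Gamma> else 0)"
      using ab fin by simp
    show ?thesis
      unfolding sum_ys mid copies f(1)
      by (simp add: char_entry_def field_simps power2_eq_square)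
  qed

  have "to_fract (char_poly (adjacency_matrix ?C vs)) = det (labelled_mat vs vs ?f)"
    by (rule to_fract_char_poly_adjacency_matrix[OF vs(1)])
  also have "\<dots> = det (labelled_mat (xs @ ms @ cs) (xs @ ms @ cs) ?f)"
    using vs dist_all set_all by (intro det_labelled_mat_cong_set) auto
  also have "\<dots> = det (labelled_mat xs xs (\<lambda>x x'. ?f x x' - (\<Sum>y\<in>set (ms @ cs). ?f x y * W y x')))
      * det (labelled_mat (ms @ cs) (ms @ cs) ?f)"
    by (rule det_labelled_mat_schur[OF dist(1) dist_ys W])
  also have "det (labelled_mat (ms @ cs) (ms @ cs) ?f) =
      det (labelled_mat ms ms ?f) * det (labelled_mat cs cs ?f)"
    using dist_ys by (intro det_labelled_mat_block_triangular) (auto simp: set)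
  also have "det (labelled_mat ms ms ?f) = ratfun_X ^ m1"
    unfolding ms_def labelled_mat_map f det_labelled_mat_scalar[OF es(1)] m1 ..
  also have "det (labelled_mat cs cs ?f) =
      (\<Prod>v\<leftarrow>vs1. det (labelled_mat (map (Copy v) vs2) (map (Copy v) vs2) ?f))"
    unfolding cs_def using vs1
    by (intro det_labelled_mat_concat[OF dist_cs[OF vs1(1)] vs1(1)]) auto
  also have "\<dots> = (\<Prod>v\<leftarrow>vs1. det (labelled_mat vs2 vs2 ?g))"
    using vs1 by (intro arg_cong[where f = prod_list] map_cong refl) (simp add: labelled_mat_map)
  also have "\<dots> = to_fract (char_poly (adjacency_matrix G2 vs2)) ^ n1"
    by (simp add: to_fract_char_poly_adjacency_matrix[OF vs2(1)] map_replicate_const n1)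
  also have "labelled_mat xs xs (\<lambda>x x'. ?f x x' - (\<Sum>y\<in>set (ms @ cs). ?f x y * W y x')) =
      inverse ratfun_X \<cdot>\<^sub>m labelled_mat vs1 vs1 (char_entry ?c G1)"
    unfolding xs_def labelled_mat_map labelled_mat_smult
    by (intro labelled_mat_cong S) (simp_all add: vs1)
  \<comment> \<open>Each of the \<open>n1\<close> rows contributes one factor
    \<open>1 / x\<close>.\<close>
  also have "det \<dots> = inverse ratfun_X ^ n1 * det (labelled_mat vs1 vs1 (char_entry ?c G1))"
    by (simp add: n1)
  also have "det (labelled_mat vs1 vs1 (char_entry ?c G1)) =
      (\<Prod>i = 1..n1. ?c - ratfun_const (nth_eigenvalue (adjacency_matrix G1 vs1) i))"
    unfolding labelled_mat_char_entry[OF vs1(1)] n1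
    using prod_nth_eigenvalue[OF comm_ring_hom_ratfun_const adjacency_matrix_carrier
        transpose_adjacency_matrix[OF assms(1)], of ?c vs1]
    by (simp add: n1)
  \<comment> \<open>The midpoints give \<open>x^m1\<close> and the Schur complement
    \<open>x^(-n1)\<close>. As \<open>m1\<close> may be less than \<open>n1\<close>, the exponent is
    an integer, and merging the powers uses that \<open>x\<close> is nonzero.\<close>
  finally show ?thesis
    by (simp add: power_int_diff power_inverse divide_inverse mult_ac)
qed

end
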